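(* Let $f$ be the associated metric on $(M,g,Q)$, let $p\in M$, let $\{i,Qi,Q^2i\}$ be an orthonormal $Q$-basis of $T_pM$, and let $p_{xyz}$ be the coordinate system in $T_pM$ such that the vectors $i$, $Qi$, $Q^2i$ are on the axes $p_x$, $p_y$, $p_z$, respectively. Let $F(x,y,z)=P(x,y,z)\,i+R(x,y,z)\,Qi+S(x,y,z)\,Q^2i$ (with $P,R,S$ smooth functions) be an isotropic vector force field acting along a smooth isotropic curve $c: r(t)=x(t)\,i+y(t)\,Qi+z(t)\,Q^2i$, $t\in[\alpha,\beta]\subset\mathbb{R}$. Let $A=\int_c f(F,dr)$ be the work done by $F$ along $c$. Then: (i) if $F$ and $c$ are on the same direction, then $A=0$; (ii) if $F$ and $c$ are on different directions and $dx+dy=0$ along $c$, then $x=k_1$ and $y=k_2$ are constant along $c$ and, with $c$ parametrized by $z=t$, $t\in[\alpha,\beta]$, $$A=\int_\alpha^\beta\big(P(k_1,k_2,t)+R(k_1,k_2,t)\big)\,dt;$$ (iii) if $F$ and $c$ are on different directions and $P+R=0$ along $c$, then $$A=\int_\alpha^\beta S(x(t),y(t),z(t))\,[x'(t)+y'(t)]\,dt;$$ (iv) if $F$ and $c$ are on different directions and $dx+dy\neq 0$ and $P+R\neq 0$ along $c$, then $$A=\int_\alpha^\beta\frac{(Py'-Rx')^2}{(P+R)(x'+y')}\,dt,$$ where $P$ and $R$ are evaluated at $(x(t),y(t),z(t))$.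
   Context: $M$ is a 3-dimensional differentiable manifold with a Riemannian (positive definite) metric $g$ and a $(1,1)$-tensor field $Q$ (an endomorphism of each tangent space) whose local components with respect to some coordinate system form the circulant matrix $$(Q_i^j)=\begin{pmatrix}0&1&0\\0&0&1\\1&0&0\end{pmatrix},$$ so that $Q^3=\mathrm{id}$, and such that $g(Qu,Qv)=g(u,v)$ for all $u,v\in T_pM$. The associated metric $f$ on $(M,g,Q)$ is the symmetric bilinear form $f(u,v)=g(u,Qv)+g(Qu,v)$. A $Q$-basis of $T_pM$ is a basis of the form $\{i,Qi,Q^2i\}$ with $i\in T_pM$; in every $T_pM$ there exists a $Q$-basis that is orthonormal with respect to $g$. A vector $v\in T_pM$ is isotropic if $f(v,v)=0$. A vector field is isotropic if all of its vectors are isotropic. A curve $c$ in $T_pM$ is isotropic if its tangent vectors are everywhere isotropic, i.e. $f(dr,dr)=0$, where $dr=dx\,i+dy\,Qi+dz\,Q^2i$. Thus here $T_pM$ is regarded as a 3-dimensional space with coordinates $(x,y,z)$ relative to $\{i,Qi,Q^2i\}$, the field $F$ and the curve $c$ live in this space, and the work is $A=\int_\alpha^\beta f\big(F(x(t),y(t),z(t)),r'(t)\big)\,dt$. "$F$ and $c$ are on the same direction" means that along $c$ the vectors $F$ and $dr$ are collinear, $F=k\,dr$ with $k\neq 0$ a function; "on different directions" means that along $c$ the vectors $F$ and $dr$ are not collinear. *)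

theory Defs
  imports "HOL-Analysis.Analysis" "HOL-Library.Function_Algebras"
begin

text \<open>Pointwise scaling makes functions into a real vector space (addition is that of
  Function_Algebras).  Tangent vectors are functions assigning components to charts, so the
  library notions of span and independence apply to them.\<close>

instantiation "fun" :: (type, real_vector) real_vector
begin

definition scaleR_fun :: "real \<Rightarrow> ('a \<Rightarrow> 'b) \<Rightarrow> 'a \<Rightarrow> 'b" where
  "scaleR_fun a u = (\<lambda>x. a *\<^sub>R u x)"

instance
  by standard (auto simp: scaleR_fun_def fun_eq_iff scaleR_add_right scaleR_add_left)

end

section \<open>Smooth maps\<close>

text \<open>The directional derivatives of f are required to be of class C^k.
  Only used for open S and for intervals {a..b} with a < b, where the derivative within S is
  unique (one-sided at the end points of an interval).\<close>

primrec Ck_on :: "nat \<Rightarrow> 'a::real_normed_vector set \<Rightarrow> ('a \<Rightarrow> 'b::real_normed_vector) \<Rightarrow> bool" where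
  "Ck_on 0 S f \<longleftrightarrow> continuous_on S f"
| "Ck_on (Suc k) S f \<longleftrightarrow> f differentiable_on S \<and>
     (\<forall>v. Ck_on k S (\<lambda>x. frechet_derivative f (at x within S) v))"

definition smooth_on :: "'a::real_normed_vector set \<Rightarrow> ('a \<Rightarrow> 'b::real_normed_vector) \<Rightarrow> bool" where
  "smooth_on S f \<longleftrightarrow> (\<forall>k. Ck_on k S f)"

section \<open>3-dimensional differentiable manifolds\<close>

text \<open>The manifold is the whole type 'm.  A chart is a domain together with a coordinate map,
  whose values outside the domain are irrelevant.\<close>

type_synonym 'm chart = "'m set \<times> ('m \<Rightarrow> real^3)"

definition codomain :: "'m chart \<Rightarrow> (real^3) set" where
  "codomain c = snd c ` fst c"

definition chart_inv :: "'m chart \<Rightarrow> real^3 \<Rightarrow> 'm" where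
  "chart_inv c = inv_into (fst c) (snd c)"

definition is_chart :: "'m::topological_space chart \<Rightarrow> bool" where
  "is_chart c \<longleftrightarrow> open (fst c) \<and> open (codomain c) \<and>
     homeomorphism (fst c) (codomain c) (snd c) (chart_inv c)"

definition smooth_transition :: "'m chart \<Rightarrow> 'm chart \<Rightarrow> bool" where
  "smooth_transition c d \<longleftrightarrow> smooth_on (snd c ` (fst c \<inter> fst d)) (snd d \<circ> chart_inv c)"

definition compatible :: "'m chart \<Rightarrow> 'm chart \<Rightarrow> bool" where
  "compatible c d \<longleftrightarrow> smooth_transition c d \<and> smooth_transition d c"

text \<open>A differentiable structure is a maximal atlas, so that its members are exactly the
  admissible coordinate systems.\<close>

definition smooth_structure :: "'m::topological_space chart set \<Rightarrow> bool" where
  "smooth_structure A \<longleftrightarrow>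
     (\<forall>c\<in>A. is_chart c) \<and> (\<Union>c\<in>A. fst c) = UNIV \<and>
     (\<forall>c\<in>A. \<forall>d\<in>A. compatible c d) \<and>
     (\<forall>c. is_chart c \<and> (\<forall>d\<in>A. compatible c d) \<longrightarrow> c \<in> A)"

section \<open>Tangent spaces\<close>

definition transition_deriv :: "'m chart \<Rightarrow> 'm chart \<Rightarrow> 'm \<Rightarrow> real^3 \<Rightarrow> real^3" where
  "transition_deriv c d p = frechet_derivative (snd d \<circ> chart_inv c) (at (snd c p))"

text \<open>A tangent vector at p is given by its components in every chart around p, related by the
  Jacobians of the coordinate changes; the value is 0 for all other charts, so that
  distinct functions are distinct tangent vectors.\<close>

type_synonym 'm tvec = "'m chart \<Rightarrow> real^3"

definition tangent_space :: "'m chart set \<Rightarrow> 'm \<Rightarrow> 'm tvec set" where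
  "tangent_space A p = {v.
     (\<forall>c. \<not> (c \<in> A \<and> p \<in> fst c) \<longrightarrow> v c = 0) \<and>
     (\<forall>c\<in>A. \<forall>d\<in>A. p \<in> fst c \<inter> fst d \<longrightarrow> v d = transition_deriv c d p (v c))}"

text \<open>The i-th coordinate vector of the chart c at q; its component in c itself is axis i 1.\<close>

definition coord_vec :: "'m chart set \<Rightarrow> 'm chart \<Rightarrow> 'm \<Rightarrow> 3 \<Rightarrow> 'm tvec" where
  "coord_vec A c q i = (\<lambda>d. if d \<in> A \<and> q \<in> fst d then transition_deriv c d q (axis i 1) else 0)"

section \<open>The manifold (M, g, Q) and the associated metric\<close>

type_synonym 'm metric = "'m \<Rightarrow> 'm tvec \<Rightarrow> 'm tvec \<Rightarrow> real"
type_synonym 'm endo = "'m \<Rightarrow> 'm tvec \<Rightarrow> 'm tvec"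

definition riemannian_metric :: "'m chart set \<Rightarrow> 'm metric \<Rightarrow> bool" where
  "riemannian_metric A g \<longleftrightarrow>
     (\<forall>p. \<forall>u\<in>tangent_space A p. \<forall>v\<in>tangent_space A p. g p u v = g p v u) \<and>
     (\<forall>p. \<forall>u\<in>tangent_space A p. \<forall>v\<in>tangent_space A p. \<forall>w\<in>tangent_space A p. \<forall>a b.
        g p (a *\<^sub>R u + b *\<^sub>R v) w = a * g p u w + b * g p v w) \<and>
     (\<forall>p. \<forall>u\<in>tangent_space A p. u \<noteq> 0 \<longrightarrow> g p u u > 0) \<and>
     (\<forall>c\<in>A. \<forall>i j. smooth_on (codomain c)
        (\<lambda>a. g (chart_inv c a) (coord_vec A c (chart_inv c a) i) (coord_vec A c (chart_inv c a) j)))"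

definition circ :: "real^3^3" where
  "circ = vector [vector [0, 1, 0],
                  vector [0, 0, 1],
                  vector [1, 0, 0]]"

text \<open>In the matrix with entries Q_i^j the lower index i is the row.  As the components are
  constant in the charts used here, Q is automatically smooth.\<close>

definition circulant_structure :: "'m chart set \<Rightarrow> 'm endo \<Rightarrow> bool" where
  "circulant_structure A Q \<longleftrightarrow>
     (\<forall>p. \<forall>u\<in>tangent_space A p. Q p u \<in> tangent_space A p) \<and>
     (\<forall>p. \<forall>u\<in>tangent_space A p. \<forall>v\<in>tangent_space A p. \<forall>a b.
        Q p (a *\<^sub>R u + b *\<^sub>R v) = a *\<^sub>R Q p u + b *\<^sub>R Q p v) \<and>
     (\<forall>p. \<exists>c\<in>A. p \<in> fst c \<and> (\<forall>q\<in>fst c. \<forall>i.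
        Q q (coord_vec A c q i) = (\<Sum>j\<in>UNIV. (circ $ i $ j) *\<^sub>R coord_vec A c q j)))"

definition circulant_manifold ::
  "'m::{t2_space, second_countable_topology} chart set \<Rightarrow> 'm metric \<Rightarrow> 'm endo \<Rightarrow> bool" where
  "circulant_manifold A g Q \<longleftrightarrow>
     smooth_structure A \<and> riemannian_metric A g \<and> circulant_structure A Q \<and>
     (\<forall>p. \<forall>u\<in>tangent_space A p. \<forall>v\<in>tangent_space A p. g p (Q p u) (Q p v) = g p u v)"

definition assoc_metric :: "'m metric \<Rightarrow> 'm endo \<Rightarrow> 'm metric" where
  "assoc_metric g Q p u v = g p u (Q p v) + g p (Q p u) v"

definition isotropic :: "'m metric \<Rightarrow> 'm endo \<Rightarrow> 'm \<Rightarrow> 'm tvec \<Rightarrow> bool" where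
  "isotropic g Q p v \<longleftrightarrow> assoc_metric g Q p v v = 0"

section \<open>Q-bases, curves and work in a tangent space\<close>

definition Q_basis :: "'m chart set \<Rightarrow> 'm endo \<Rightarrow> 'm \<Rightarrow> 'm tvec \<Rightarrow> bool" where
  "Q_basis A Q p e \<longleftrightarrow> e \<in> tangent_space A p \<and>
     distinct [e, Q p e, Q p (Q p e)] \<and>
     independent {e, Q p e, Q p (Q p e)} \<and>
     span {e, Q p e, Q p (Q p e)} = tangent_space A p"

definition orthonormal_Q_basis ::
  "'m chart set \<Rightarrow> 'm metric \<Rightarrow> 'm endo \<Rightarrow> 'm \<Rightarrow> 'm tvec \<Rightarrow> bool" where
  "orthonormal_Q_basis A g Q p e \<longleftrightarrow> Q_basis A Q p e \<and>
     (\<forall>u\<in>{e, Q p e, Q p (Q p e)}. \<forall>v\<in>{e, Q p e, Q p (Q p e)}. g p u v = (if u = v then 1 else 0))"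

text \<open>The vector with coordinates a, b, c relative to e, Qe, QQe.\<close>

definition of_coords :: "'m endo \<Rightarrow> 'm \<Rightarrow> 'm tvec \<Rightarrow> real \<Rightarrow> real \<Rightarrow> real \<Rightarrow> 'm tvec" where
  "of_coords Q p e a b c = a *\<^sub>R e + b *\<^sub>R Q p e + c *\<^sub>R Q p (Q p e)"

definition deriv_on :: "real set \<Rightarrow> (real \<Rightarrow> real) \<Rightarrow> real \<Rightarrow> real" where
  "deriv_on I x t = vector_derivative x (at t within I)"

text \<open>A curve in the tangent space is given by its coordinate functions x, y, z.\<close>

definition velocity :: "'m endo \<Rightarrow> 'm \<Rightarrow> 'm tvec \<Rightarrow> real set \<Rightarrow>
    (real \<Rightarrow> real) \<Rightarrow> (real \<Rightarrow> real) \<Rightarrow> (real \<Rightarrow> real) \<Rightarrow> real \<Rightarrow> 'm tvec" where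
  "velocity Q p e I x y z t = of_coords Q p e (deriv_on I x t) (deriv_on I y t) (deriv_on I z t)"

definition work :: "'m metric \<Rightarrow> 'm endo \<Rightarrow> 'm \<Rightarrow> 'm tvec \<Rightarrow> (real \<Rightarrow> real \<Rightarrow> real \<Rightarrow> 'm tvec) \<Rightarrow>
    real set \<Rightarrow> (real \<Rightarrow> real) \<Rightarrow> (real \<Rightarrow> real) \<Rightarrow> (real \<Rightarrow> real) \<Rightarrow> real" where
  "work g Q p e F I x y z =
     integral I (\<lambda>t. assoc_metric g Q p (F (x t) (y t) (z t)) (velocity Q p e I x y z t))"

text \<open>Collinear in the sense u = k v with k nonzero; this makes 0 collinear only with 0.\<close>

definition collinear_vecs :: "'m tvec \<Rightarrow> 'm tvec \<Rightarrow> bool" where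
  "collinear_vecs u v \<longleftrightarrow> (\<exists>k. k \<noteq> 0 \<and> u = k *\<^sub>R v)"

definition same_direction :: "'m endo \<Rightarrow> 'm \<Rightarrow> 'm tvec \<Rightarrow> (real \<Rightarrow> real \<Rightarrow> real \<Rightarrow> 'm tvec) \<Rightarrow>
    real set \<Rightarrow> (real \<Rightarrow> real) \<Rightarrow> (real \<Rightarrow> real) \<Rightarrow> (real \<Rightarrow> real) \<Rightarrow> bool" where
  "same_direction Q p e F I x y z \<longleftrightarrow>
     (\<forall>t\<in>I. collinear_vecs (F (x t) (y t) (z t)) (velocity Q p e I x y z t))"

definition different_directions :: "'m endo \<Rightarrow> 'm \<Rightarrow> 'm tvec \<Rightarrow> (real \<Rightarrow> real \<Rightarrow> real \<Rightarrow> 'm tvec) \<Rightarrow>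
    real set \<Rightarrow> (real \<Rightarrow> real) \<Rightarrow> (real \<Rightarrow> real) \<Rightarrow> (real \<Rightarrow> real) \<Rightarrow> bool" where
  "different_directions Q p e F I x y z \<longleftrightarrow>
     (\<forall>t\<in>I. \<not> collinear_vecs (F (x t) (y t) (z t)) (velocity Q p e I x y z t))"

text \<open>An orientation-preserving change of parameter from [a,b] to [\<alpha>,\<beta>].\<close>

definition reparametrization :: "(real \<Rightarrow> real) \<Rightarrow> real \<Rightarrow> real \<Rightarrow> real \<Rightarrow> real \<Rightarrow> bool" where
  "reparametrization \<phi> a b \<alpha> \<beta> \<longleftrightarrow> a < b \<and> smooth_on {a..b} \<phi> \<and>
     strict_mono_on {a..b} \<phi> \<and> bij_betw \<phi> {a..b} {\<alpha>..\<beta>}"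

end

theory Submission
  imports Defs
begin

text \<open>
  Relative to an orthonormal Q-basis the structure Q permutes the coordinates cyclically, so the
  associated metric is the constant bilinear form
  a (b' + c') + b (a' + c') + c (a' + b'), and a vector (a, b, c) is isotropic exactly when
  a b + (a + b) c = 0 (lemmas \<open>assoc_metric_of_coords\<close> and \<open>isotropic_of_coords_iff\<close>).  Each of the
  four formulas is then a pointwise identity between integrands.  If the field is k times the
  velocity, the integrand is k times the vanishing square of the velocity.  If the sum of the first
  two coordinates of an isotropic vector vanishes, then both of them vanish, because
  a b = - a^2; applied to the velocity this makes x and y constant, and applied to the field it
  leaves only the S-term.  If the sums are nonzero, the isotropy equations can be solved for the
  third coordinates of the field and of the velocity, and the integrand becomes a perfect square
  over the product of the sums.  In the case of constant x and y the integrand is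
  (P + R) z', and the substitution of z for the parameter finishes the computation.

  The only geometric input is the cyclic action of Q on the given basis, that is, Q^3 = id.
  Orthonormality and the invariance of g under Q alone give this only up to sign.  The identity is
  immediate on the coordinate vectors of an adapted chart, and it extends to the tangent space
  because these vectors are tangent and span (lemmas \<open>coord_vec_in_tangent_space\<close> and
  \<open>tangent_vector_expansion\<close>, which rest on the chain rule for chart transitions).
\<close>

section \<open>Chart transitions and coordinate vectors\<close>

lemma smooth_on_imp_differentiable_on:
  assumes "smooth_on S f"
  shows "f differentiable_on S"
proof -
  have "Ck_on (Suc 0) S f"
    using assms unfolding smooth_on_def by blast
  then show ?thesis by simp
qed

lemma open_chart_image:
  assumes "is_chart c" "open U"
  shows "open (snd c ` (fst c \<inter> U))"
proof -
  have hom: "homeomorphism (fst c) (codomain c) (snd c) (chart_inv c)" and "open (codomain c)"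
    using assms(1) by (auto simp: is_chart_def)
  have "openin (top_of_set (codomain c)) (snd c ` (fst c \<inter> U))"
    by (rule homeomorphism_imp_open_map[OF hom]) (simp add: openin_open_Int assms(2))
  then show ?thesis
    using \<open>open (codomain c)\<close> openin_open_trans by blast
qed

lemma chart_inv_chart:
  assumes "is_chart c" "q \<in> fst c"
  shows "chart_inv c (snd c q) = q"
  using assms by (auto simp: is_chart_def homeomorphism_def)

lemma transition_has_derivative:
  assumes "smooth_structure A" "c \<in> A" "d \<in> A" "q \<in> fst c" "q \<in> fst d"
  shows "((snd d \<circ> chart_inv c) has_derivative transition_deriv c d q) (at (snd c q))"
proof -
  let ?S = "snd c ` (fst c \<inter> fst d)"
  have charts: "is_chart c" "is_chart d" and compat: "compatible c d"
    using assms by (auto simp: smooth_structure_def)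
  have "open ?S"
    using open_chart_image[OF charts(1)] charts(2) by (simp add: is_chart_def)
  moreover have "snd c q \<in> ?S"
    using assms by blast
  moreover have "(snd d \<circ> chart_inv c) differentiable_on ?S"
    using compat by (simp add: compatible_def smooth_transition_def smooth_on_imp_differentiable_on)
  ultimately have "(snd d \<circ> chart_inv c) differentiable at (snd c q)"
    by (metis at_within_open differentiable_on_def)
  then show ?thesis
    unfolding transition_deriv_def by (simp add: frechet_derivative_works)
qed

text \<open>The cocycle rule for Jacobians: near the point the transition from b to d factors through c,
  so this is the chain rule together with uniqueness of derivatives.\<close>

lemma transition_deriv_compose:
  assumes A: "smooth_structure A" and "b \<in> A" "c \<in> A" "d \<in> A"
    and q: "q \<in> fst b" "q \<in> fst c" "q \<in> fst d"
  shows "transition_deriv b d q = transition_deriv c d q \<circ> transition_deriv b c q"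
proof -
  let ?S = "snd b ` (fst b \<inter> fst c)"
  have charts: "is_chart b" "is_chart c"
    using assms by (auto simp: smooth_structure_def)
  have at_q: "(snd c \<circ> chart_inv b) (snd b q) = snd c q"
    using chart_inv_chart[OF charts(1) q(1)] by simp
  have "((snd d \<circ> chart_inv c) \<circ> (snd c \<circ> chart_inv b) has_derivative
         transition_deriv c d q \<circ> transition_deriv b c q) (at (snd b q))"
    by (rule diff_chain_at) (use assms at_q in \<open>simp_all only: transition_has_derivative\<close>)
  then have "((snd d \<circ> chart_inv b) has_derivative
         transition_deriv c d q \<circ> transition_deriv b c q) (at (snd b q))"
  proof (rule has_derivative_transform_within_open)
    show "open ?S"
      using open_chart_image[OF charts(1)] charts(2) by (simp add: is_chart_def)
    show "snd b q \<in> ?S"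
      using q by blast
    show "((snd d \<circ> chart_inv c) \<circ> (snd c \<circ> chart_inv b)) u = (snd d \<circ> chart_inv b) u"
      if "u \<in> ?S" for u
      using that charts by (auto simp: chart_inv_chart)
  qed
  then show ?thesis
    using transition_has_derivative[OF A \<open>b \<in> A\<close> \<open>d \<in> A\<close> q(1,3)] has_derivative_unique by blast
qed

lemma coord_vec_in_tangent_space:
  assumes "smooth_structure A" "c \<in> A" "q \<in> fst c"
  shows "coord_vec A c q i \<in> tangent_space A q"
  unfolding tangent_space_def
proof (clarsimp simp: coord_vec_def)
  fix b B and d D
  assume "(b, B) \<in> A" "q \<in> b" "(d, D) \<in> A" "q \<in> d"
  then have "transition_deriv c (d, D) q = transition_deriv (b, B) (d, D) q \<circ> transition_deriv c (b, B) q"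
    using assms by (intro transition_deriv_compose) auto
  then show "transition_deriv c (d, D) q (axis i 1) =
      transition_deriv (b, B) (d, D) q (transition_deriv c (b, B) q (axis i 1))"
    by simp
qed

text \<open>A tangent vector is determined by its component in one chart, and its other components depend
  linearly on that one; so the expansion of the component in the standard basis lifts.\<close>

lemma tangent_vector_expansion:
  assumes A: "smooth_structure A" and c: "c \<in> A" "q \<in> fst c" and u: "u \<in> tangent_space A q"
  shows "u = (\<Sum>i\<in>UNIV. (u c $ i) *\<^sub>R coord_vec A c q i)"
proof
  fix d
  show "u d = (\<Sum>i\<in>UNIV. (u c $ i) *\<^sub>R coord_vec A c q i) d"
  proof (cases "d \<in> A \<and> q \<in> fst d")
    case True
    then interpret T: linear "transition_deriv c d q"
      using transition_has_derivative[OF A] c has_derivative_linear by blast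
    have "u c = (\<Sum>i\<in>UNIV. (u c $ i) *\<^sub>R axis i 1)"
      by (simp add: vec_eq_iff axis_def sum_3 forall_3)
    then have "transition_deriv c d q (u c) =
        (\<Sum>i\<in>UNIV. (u c $ i) *\<^sub>R transition_deriv c d q (axis i 1))"
      by (metis (no_types, lifting) T.sum T.scaleR sum.cong)
    moreover have "u d = transition_deriv c d q (u c)"
      using u c True unfolding tangent_space_def by blast
    ultimately show ?thesis
      using True by (simp add: coord_vec_def sum_3 scaleR_fun_def)
  next
    case False
    then have "u d = 0"
      using u unfolding tangent_space_def by blast
    then show ?thesis
      using False by (auto simp: coord_vec_def sum_3 scaleR_fun_def)
  qed
qed

section \<open>The associated metric in an orthonormal Q-basis\<close>

lemma subspace_tangent_space:
  assumes "Q_basis A Q p e"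
  shows "subspace (tangent_space A p)"
  using assms subspace_span by (metis Q_basis_def)

lemma endo_tangent:
  assumes "circulant_structure A Q" "u \<in> tangent_space A p"
  shows "Q p u \<in> tangent_space A p"
  using assms by (simp add: circulant_structure_def)

lemma endo_comb3:
  assumes Q: "circulant_structure A Q" and sub: "subspace (tangent_space A p)"
    and "u \<in> tangent_space A p" "v \<in> tangent_space A p" "w \<in> tangent_space A p"
  shows "Q p (a *\<^sub>R u + b *\<^sub>R v + c *\<^sub>R w) = a *\<^sub>R Q p u + b *\<^sub>R Q p v + c *\<^sub>R Q p w"
proof -
  have lin: "Q p (k *\<^sub>R r + l *\<^sub>R s) = k *\<^sub>R Q p r + l *\<^sub>R Q p s"
    if "r \<in> tangent_space A p" "s \<in> tangent_space A p" for k l r s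
    using Q that by (simp add: circulant_structure_def)
  have "a *\<^sub>R u + b *\<^sub>R v \<in> tangent_space A p"
    using assms by (simp add: subspace_add subspace_scale)
  then have "Q p (1 *\<^sub>R (a *\<^sub>R u + b *\<^sub>R v) + c *\<^sub>R w) = 1 *\<^sub>R Q p (a *\<^sub>R u + b *\<^sub>R v) + c *\<^sub>R Q p w"
    using assms by (intro lin) auto
  then show ?thesis
    using lin assms by simp
qed

text \<open>On the coordinate vectors of an adapted chart Q is a cyclic permutation, hence of order
  three; linearity carries this over to every tangent vector.\<close>

lemma endo_cubed:
  assumes A: "smooth_structure A" and Q: "circulant_structure A Q"
    and sub: "subspace (tangent_space A p)" and u: "u \<in> tangent_space A p"
  shows "Q p (Q p (Q p u)) = u"
proof -
  obtain c where c: "c \<in> A" "p \<in> fst c"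
    and rows: "\<And>i. Q p (coord_vec A c p i) = (\<Sum>j\<in>UNIV. (circ $ i $ j) *\<^sub>R coord_vec A c p j)"
  proof -
    from Q have "\<exists>c\<in>A. p \<in> fst c \<and> (\<forall>q\<in>fst c. \<forall>i.
        Q q (coord_vec A c q i) = (\<Sum>j\<in>UNIV. (circ $ i $ j) *\<^sub>R coord_vec A c q j))"
      unfolding circulant_structure_def by (elim conjE) (erule spec)
    then show ?thesis
      using that by blast
  qed
  let ?v = "coord_vec A c p"
  have perm: "Q p (?v 1) = ?v 2" "Q p (?v 2) = ?v 3" "Q p (?v 3) = ?v 1"
    by (simp_all add: rows sum_3 circ_def)
  have "?v i \<in> tangent_space A p" for i
    using coord_vec_in_tangent_space[OF A c] .
  note comb = endo_comb3[OF Q sub this this this]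
  have "u = (u c $ 1) *\<^sub>R ?v 1 + (u c $ 2) *\<^sub>R ?v 2 + (u c $ 3) *\<^sub>R ?v 3" (is "u = ?w")
    using tangent_vector_expansion[OF A c u] by (simp add: sum_3)
  moreover have "Q p (Q p (Q p ?w)) = ?w"
    by (simp add: comb perm)
  ultimately show ?thesis by simp
qed

lemma endo_of_coords:
  assumes M: "circulant_manifold A g Q" and e: "Q_basis A Q p e"
  shows "Q p (of_coords Q p e a b c) = of_coords Q p e c a b"
proof -
  have A: "smooth_structure A" and Q: "circulant_structure A Q"
    using M by (auto simp: circulant_manifold_def)
  have tangent: "e \<in> tangent_space A p"
    using e by (simp add: Q_basis_def)
  note sub = subspace_tangent_space[OF e]
  show ?thesis
    unfolding of_coords_def
    by (simp add: endo_comb3[OF Q sub] tangent endo_tangent[OF Q] endo_cubed[OF A Q sub tangent])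
qed

lemma metric_comb3_left:
  assumes g: "riemannian_metric A g" and sub: "subspace (tangent_space A p)"
    and "u \<in> tangent_space A p" "v \<in> tangent_space A p" "w \<in> tangent_space A p" "r \<in> tangent_space A p"
  shows "g p (a *\<^sub>R u + b *\<^sub>R v + c *\<^sub>R w) r = a * g p u r + b * g p v r + c * g p w r"
proof -
  have lin: "g p (k *\<^sub>R s + l *\<^sub>R t) r = k * g p s r + l * g p t r"
    if "s \<in> tangent_space A p" "t \<in> tangent_space A p" for k l s t
    using g that assms(6) unfolding riemannian_metric_def by blast
  have "a *\<^sub>R u + b *\<^sub>R v \<in> tangent_space A p"
    using assms by (simp add: subspace_add subspace_scale)
  then have "g p (1 *\<^sub>R (a *\<^sub>R u + b *\<^sub>R v) + c *\<^sub>R w) r = 1 * g p (a *\<^sub>R u + b *\<^sub>R v) r + c * g p w r"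
    using assms by (intro lin) auto
  then show ?thesis
    using lin assms by simp
qed

lemma metric_of_coords:
  assumes M: "circulant_manifold A g Q" and e: "orthonormal_Q_basis A g Q p e"
  shows "g p (of_coords Q p e a b c) (of_coords Q p e a' b' c') = a * a' + b * b' + c * c'"
proof -
  have g: "riemannian_metric A g" and Q: "circulant_structure A Q"
    using M by (auto simp: circulant_manifold_def)
  have basis: "Q_basis A Q p e"
    using e by (simp add: orthonormal_Q_basis_def)
  note sub = subspace_tangent_space[OF basis]
  define e1 e2 where "e1 = Q p e" and "e2 = Q p (Q p e)"
  have tangent: "e \<in> tangent_space A p" "e1 \<in> tangent_space A p" "e2 \<in> tangent_space A p"
    using basis endo_tangent[OF Q] by (auto simp: Q_basis_def e1_def e2_def)
  have dist: "e \<noteq> e1" "e \<noteq> e2" "e1 \<noteq> e2"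
    using basis by (auto simp: Q_basis_def e1_def e2_def)
  have orth: "g p u v = (if u = v then 1 else 0)" if "u \<in> {e, e1, e2}" "v \<in> {e, e1, e2}" for u v
    using e that unfolding orthonormal_Q_basis_def e1_def e2_def by blast
  let ?r = "a' *\<^sub>R e + b' *\<^sub>R e1 + c' *\<^sub>R e2"
  have r: "?r \<in> tangent_space A p"
    using tangent sub by (simp add: subspace_add subspace_scale)
  have comp: "g p u ?r = a' * g p e u + b' * g p e1 u + c' * g p e2 u"
    if "u \<in> tangent_space A p" for u
  proof -
    have "g p u ?r = g p ?r u"
      using g r that unfolding riemannian_metric_def by blast
    also have "\<dots> = a' * g p e u + b' * g p e1 u + c' * g p e2 u"
      by (rule metric_comb3_left[OF g sub tangent that])
    finally show ?thesis .
  qed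
  have "g p (a *\<^sub>R e + b *\<^sub>R e1 + c *\<^sub>R e2) ?r = a * g p e ?r + b * g p e1 ?r + c * g p e2 ?r"
    by (rule metric_comb3_left[OF g sub tangent r])
  also have "\<dots> = a * a' + b * b' + c * c'"
    using dist by (simp add: comp tangent orth)
  finally show ?thesis
    by (simp add: of_coords_def e1_def e2_def)
qed

lemma assoc_metric_of_coords:
  assumes "circulant_manifold A g Q" "orthonormal_Q_basis A g Q p e"
  shows "assoc_metric g Q p (of_coords Q p e a b c) (of_coords Q p e a' b' c') =
    a * (b' + c') + b * (a' + c') + c * (a' + b')"
proof -
  have "Q_basis A Q p e"
    using assms(2) by (simp add: orthonormal_Q_basis_def)
  then show ?thesis
    using assms
    by (simp add: assoc_metric_def endo_of_coords metric_of_coords algebra_simps)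
qed

lemma isotropic_of_coords_iff:
  assumes "circulant_manifold A g Q" "orthonormal_Q_basis A g Q p e"
  shows "isotropic g Q p (of_coords Q p e a b c) \<longleftrightarrow> a * b + (a + b) * c = 0"
proof -
  have "assoc_metric g Q p (of_coords Q p e a b c) (of_coords Q p e a b c) =
      2 * (a * b + (a + b) * c)"
    using assms by (simp add: assoc_metric_of_coords algebra_simps)
  then show ?thesis
    unfolding isotropic_def by (simp only: mult_eq_0_iff) simp
qed

section \<open>Isotropic coordinate triples and integrals along the curve\<close>

lemma isotropic_sum_zero_imp_zero:
  fixes a b c :: real
  assumes "a * b + (a + b) * c = 0" "a + b = 0"
  shows "a = 0" "b = 0"
proof -
  have "b = - a"
    using assms(2) by simp
  with assms(1) show "a = 0" by simp
  with \<open>b = - a\<close> show "b = 0" by simp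
qed

text \<open>The isotropy equations give c = - a b / (a + b) and c' = - a' b' / (a' + b'); after
  clearing denominators the remaining identity is polynomial.\<close>

lemma isotropic_pairing_eq_square:
  fixes a b c a' b' c' :: real
  assumes "a * b + (a + b) * c = 0" "a' * b' + (a' + b') * c' = 0"
    and nz: "a + b \<noteq> 0" "a' + b' \<noteq> 0"
  shows "a * (b' + c') + b * (a' + c') + c * (a' + b') =
    (a * b' - b * a')\<^sup>2 / ((a + b) * (a' + b'))"
proof -
  have "(a * (b' + c') + b * (a' + c') + c * (a' + b')) * ((a + b) * (a' + b')) =
      (a * b' - b * a')\<^sup>2"
    using assms(1,2) by algebra
  then show ?thesis
    using nz by (simp add: eq_divide_eq)
qed

lemma smooth_on_has_deriv_on:
  assumes "smooth_on I x" "t \<in> I"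
  shows "(x has_field_derivative deriv_on I x t) (at t within I)"
  using smooth_on_imp_differentiable_on[OF assms(1)] assms(2)
  by (simp add: deriv_on_def differentiable_on_def vector_derivative_works
      has_real_derivative_iff_has_vector_derivative)

lemma constant_of_deriv_on_zero:
  assumes "smooth_on {\<alpha>..\<beta>} x" "\<And>t. t \<in> {\<alpha>..\<beta>} \<Longrightarrow> deriv_on {\<alpha>..\<beta>} x t = 0"
  shows "\<exists>k. \<forall>t\<in>{\<alpha>..\<beta>}. x t = k"
proof -
  have "\<And>t. t \<in> {\<alpha>..\<beta>} \<Longrightarrow> (x has_field_derivative 0) (at t within {\<alpha>..\<beta>})"
    using smooth_on_has_deriv_on[OF assms(1)] assms(2) by fastforce
  from has_field_derivative_zero_constant[OF _ this] show ?thesis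
    by auto
qed

text \<open>A parameter \<open>\<phi>\<close> with z (\<open>\<phi>\<close> t) = t is inverse to z, so z maps the curve's parameter interval
  onto [a,b] and takes end points to end points; then u = z s is a legitimate substitution.\<close>

lemma integral_parametrized_by_coordinate:
  fixes h z :: "real \<Rightarrow> real"
  assumes le: "\<alpha> \<le> \<beta>" and z: "smooth_on {\<alpha>..\<beta>} z" and h: "continuous_on {a..b} h"
    and \<phi>: "reparametrization \<phi> a b \<alpha> \<beta>" and inv: "\<And>t. t \<in> {a..b} \<Longrightarrow> z (\<phi> t) = t"
  shows "integral {\<alpha>..\<beta>} (\<lambda>s. h (z s) * deriv_on {\<alpha>..\<beta>} z s) = integral {a..b} h"
proof -
  have ab: "a < b" and mono: "strict_mono_on {a..b} \<phi>" and bij: "bij_betw \<phi> {a..b} {\<alpha>..\<beta>}"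
    using \<phi> by (auto simp: reparametrization_def)
  have img: "\<phi> ` {a..b} = {\<alpha>..\<beta>}"
    using bij by (simp add: bij_betw_def)
  have between: "\<phi> a \<le> \<phi> t \<and> \<phi> t \<le> \<phi> b" if "t \<in> {a..b}" for t
    using strict_mono_on_leD[OF mono] that ab by auto
  have ends: "\<phi> a = \<alpha>" "\<phi> b = \<beta>"
  proof -
    have "\<alpha> \<in> \<phi> ` {a..b}" "\<beta> \<in> \<phi> ` {a..b}" "\<phi> a \<in> {\<alpha>..\<beta>}" "\<phi> b \<in> {\<alpha>..\<beta>}"
      using img le ab by auto
    then show "\<phi> a = \<alpha>" "\<phi> b = \<beta>"
      using between by (force intro: antisym)+
  qed
  have z_ends: "z \<alpha> = a" "z \<beta> = b"
    using inv[of a] inv[of b] ends ab by auto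
  have "z ` {\<alpha>..\<beta>} \<subseteq> {a..b}"
    using inv by (auto simp flip: img)
  then have "((\<lambda>s. deriv_on {\<alpha>..\<beta>} z s *\<^sub>R h (z s)) has_integral integral {z \<alpha>..z \<beta>} h) {\<alpha>..\<beta>}"
    using le z_ends ab h smooth_on_has_deriv_on[OF z]
    by (intro has_integral_substitution[where c = a and d = b]) auto
  then show ?thesis
    by (simp add: z_ends mult.commute integral_unique)
qed

section \<open>The work of an isotropic field along an isotropic curve\<close>

theorem theorem3p1:
  fixes A :: "'m::{t2_space, second_countable_topology} chart set"
    and g :: "'m metric" and Q :: "'m endo" and p :: 'm and e :: "'m tvec"
    and F :: "real \<Rightarrow> real \<Rightarrow> real \<Rightarrow> 'm tvec"
    and P R S :: "real \<Rightarrow> real \<Rightarrow> real \<Rightarrow> real"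
    and x y z :: "real \<Rightarrow> real" and \<alpha> \<beta> :: real
  assumes manifold: "circulant_manifold A g Q"
    and basis: "orthonormal_Q_basis A g Q p e"
    and F: "\<And>a b c. F a b c = of_coords Q p e (P a b c) (R a b c) (S a b c)"
    and smooth_field: "smooth_on UNIV (\<lambda>(a, b, c). P a b c)" "smooth_on UNIV (\<lambda>(a, b, c). R a b c)"
      "smooth_on UNIV (\<lambda>(a, b, c). S a b c)"
    and interval: "\<alpha> < \<beta>"
    and smooth_curve: "smooth_on {\<alpha>..\<beta>} x" "smooth_on {\<alpha>..\<beta>} y" "smooth_on {\<alpha>..\<beta>} z"
    and isotropic_field: "\<And>a b c. isotropic g Q p (F a b c)"
    and isotropic_curve: "\<And>t. t \<in> {\<alpha>..\<beta>} \<Longrightarrow> isotropic g Q p (velocity Q p e {\<alpha>..\<beta>} x y z t)"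
  shows
    "(same_direction Q p e F {\<alpha>..\<beta>} x y z \<longrightarrow> work g Q p e F {\<alpha>..\<beta>} x y z = 0)
     \<and>
     (different_directions Q p e F {\<alpha>..\<beta>} x y z \<and>
      (\<forall>t\<in>{\<alpha>..\<beta>}. deriv_on {\<alpha>..\<beta>} x t + deriv_on {\<alpha>..\<beta>} y t = 0) \<longrightarrow>
        (\<exists>k1 k2. (\<forall>t\<in>{\<alpha>..\<beta>}. x t = k1 \<and> y t = k2) \<and>
          (\<forall>a b \<phi>. reparametrization \<phi> a b \<alpha> \<beta> \<and> (\<forall>t\<in>{a..b}. z (\<phi> t) = t) \<longrightarrow>
             work g Q p e F {\<alpha>..\<beta>} x y z = integral {a..b} (\<lambda>t. P k1 k2 t + R k1 k2 t))))
     \<and>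
     (different_directions Q p e F {\<alpha>..\<beta>} x y z \<and>
      (\<forall>t\<in>{\<alpha>..\<beta>}. P (x t) (y t) (z t) + R (x t) (y t) (z t) = 0) \<longrightarrow>
        work g Q p e F {\<alpha>..\<beta>} x y z =
          integral {\<alpha>..\<beta>} (\<lambda>t. S (x t) (y t) (z t) * (deriv_on {\<alpha>..\<beta>} x t + deriv_on {\<alpha>..\<beta>} y t)))
     \<and>
     (different_directions Q p e F {\<alpha>..\<beta>} x y z \<and>
      (\<forall>t\<in>{\<alpha>..\<beta>}. deriv_on {\<alpha>..\<beta>} x t + deriv_on {\<alpha>..\<beta>} y t \<noteq> 0) \<and>
      (\<forall>t\<in>{\<alpha>..\<beta>}. P (x t) (y t) (z t) + R (x t) (y t) (z t) \<noteq> 0) \<longrightarrow>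
        work g Q p e F {\<alpha>..\<beta>} x y z =
          integral {\<alpha>..\<beta>} (\<lambda>t.
            (P (x t) (y t) (z t) * deriv_on {\<alpha>..\<beta>} y t - R (x t) (y t) (z t) * deriv_on {\<alpha>..\<beta>} x t)\<^sup>2
            / ((P (x t) (y t) (z t) + R (x t) (y t) (z t)) *
               (deriv_on {\<alpha>..\<beta>} x t + deriv_on {\<alpha>..\<beta>} y t))))"
proof -
  let ?I = "{\<alpha>..\<beta>}"
  let ?P = "\<lambda>t. P (x t) (y t) (z t)" and ?R = "\<lambda>t. R (x t) (y t) (z t)"
    and ?S = "\<lambda>t. S (x t) (y t) (z t)"
  let ?x' = "deriv_on ?I x" and ?y' = "deriv_on ?I y" and ?z' = "deriv_on ?I z"
  let ?f = "\<lambda>t. ?P t * (?y' t + ?z' t) + ?R t * (?x' t + ?z' t) + ?S t * (?x' t + ?y' t)"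

  have work: "work g Q p e F ?I x y z = integral ?I ?f"
    by (simp add: work_def F velocity_def assoc_metric_of_coords[OF manifold basis])
  have iso_F: "P a b c * R a b c + (P a b c + R a b c) * S a b c = 0" for a b c
    using isotropic_field[of a b c] by (simp add: F isotropic_of_coords_iff[OF manifold basis])
  have iso_r: "?x' t * ?y' t + (?x' t + ?y' t) * ?z' t = 0" if "t \<in> ?I" for t
    using isotropic_curve[OF that]
    by (simp add: velocity_def isotropic_of_coords_iff[OF manifold basis])

  have case_i: "work g Q p e F ?I x y z = 0" if same: "same_direction Q p e F ?I x y z"
  proof -
    have "assoc_metric g Q p (F (x t) (y t) (z t)) (velocity Q p e ?I x y z t) = 0"
      if t: "t \<in> ?I" for t
    proof -
      obtain k where "F (x t) (y t) (z t) = k *\<^sub>R velocity Q p e ?I x y z t"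
        using same t unfolding same_direction_def collinear_vecs_def by blast
      then have k: "F (x t) (y t) (z t) = of_coords Q p e (k * ?x' t) (k * ?y' t) (k * ?z' t)"
        by (simp add: velocity_def of_coords_def scaleR_add_right)
      have "assoc_metric g Q p (F (x t) (y t) (z t)) (velocity Q p e ?I x y z t) =
          2 * k * (?x' t * ?y' t + (?x' t + ?y' t) * ?z' t)"
        unfolding k velocity_def assoc_metric_of_coords[OF manifold basis]
        by (simp add: algebra_simps)
      then show ?thesis
        using iso_r[OF t] by simp
    qed
    then have "work g Q p e F ?I x y z = integral ?I (\<lambda>t. 0)"
      unfolding work_def by (intro Henstock_Kurzweil_Integration.integral_cong)
    then show ?thesis by simp
  qed

  have case_ii: "\<exists>k1 k2. (\<forall>t\<in>?I. x t = k1 \<and> y t = k2) \<and>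
      (\<forall>a b \<phi>. reparametrization \<phi> a b \<alpha> \<beta> \<and> (\<forall>t\<in>{a..b}. z (\<phi> t) = t) \<longrightarrow>
         work g Q p e F ?I x y z = integral {a..b} (\<lambda>t. P k1 k2 t + R k1 k2 t))"
    if sum0: "\<forall>t\<in>?I. ?x' t + ?y' t = 0"
  proof -
    have zero: "?x' t = 0" "?y' t = 0" if "t \<in> ?I" for t
      using isotropic_sum_zero_imp_zero[OF iso_r[OF that]] bspec[OF sum0 that] by blast+
    obtain k1 k2 where k: "\<forall>t\<in>?I. x t = k1" "\<forall>t\<in>?I. y t = k2"
      using constant_of_deriv_on_zero[OF smooth_curve(1)]
        constant_of_deriv_on_zero[OF smooth_curve(2)] zero by blast
    let ?h = "\<lambda>u. P k1 k2 u + R k1 k2 u"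
    have cont: "continuous_on T ?h" for T
    proof -
      have line: "continuous_on T (\<lambda>u. G (k1, k2, u))"
        if "smooth_on UNIV G" for G :: "real \<times> real \<times> real \<Rightarrow> real"
      proof -
        have "continuous_on UNIV G"
          using smooth_on_imp_differentiable_on[OF that] by (rule differentiable_imp_continuous_on)
        then show ?thesis
          by (rule continuous_on_compose2) (auto intro!: continuous_intros)
      qed
      show ?thesis
        using line[OF smooth_field(1)] line[OF smooth_field(2)]
        by (auto intro: continuous_on_add)
    qed
    have "work g Q p e F ?I x y z = integral ?I (\<lambda>s. ?h (z s) * ?z' s)"
      unfolding work
      by (rule Henstock_Kurzweil_Integration.integral_cong) (simp add: zero k algebra_simps)
    then have "work g Q p e F ?I x y z = integral {a..b} ?h"
      if "reparametrization \<phi> a b \<alpha> \<beta>" "\<forall>t\<in>{a..b}. z (\<phi> t) = t" for a b \<phi>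
      using integral_parametrized_by_coordinate[OF less_imp_le[OF interval] smooth_curve(3) cont
          that(1)] that(2) by simp
    then show ?thesis
      using k by blast
  qed

  have case_iii: "work g Q p e F ?I x y z = integral ?I (\<lambda>t. ?S t * (?x' t + ?y' t))"
    if sum0: "\<forall>t\<in>?I. ?P t + ?R t = 0"
  proof -
    have "?P t = 0" "?R t = 0" if "t \<in> ?I" for t
      using isotropic_sum_zero_imp_zero[OF iso_F] bspec[OF sum0 that] by blast+
    then show ?thesis
      unfolding work by (intro Henstock_Kurzweil_Integration.integral_cong) simp
  qed

  have case_iv: "work g Q p e F ?I x y z =
      integral ?I (\<lambda>t. (?P t * ?y' t - ?R t * ?x' t)\<^sup>2 / ((?P t + ?R t) * (?x' t + ?y' t)))"
    if "\<forall>t\<in>?I. ?x' t + ?y' t \<noteq> 0" "\<forall>t\<in>?I. ?P t + ?R t \<noteq> 0"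
    unfolding work
    by (rule Henstock_Kurzweil_Integration.integral_cong, rule isotropic_pairing_eq_square)
      (use iso_F iso_r that in auto)

  show ?thesis
    using case_i case_ii case_iii case_iv by blast
qed

end
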